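(* Let $n$ be a positive integer, and put $$r_1:=\left\lfloor\frac{3n-1-\sqrt{12n+13}}{3}\right\rfloor+1,\qquad r_2:=\left\lceil\frac{3n-1+\sqrt{12n+13}}{3}\right\rceil-1.$$ Then $$\frac{1}{\Theta_6(q)}=q^{-\frac{3n^2+n}{2}}\sum_{\substack{k=r_1\\ k\equiv n\ (\mathrm{mod}\ 2)}}^{r_2}(-1)^{\frac{n-k}{2}}A_k(q)\,C_{\frac{3n-k}{2}}(q)+O(q^{n+1}).$$
   Context: Here $(a;q)_\infty:=\prod_{j=0}^\infty(1-aq^j)$, and $O(q^{n+1})$ denotes a formal power series in $q$ all of whose terms have exponent at least $n+1$. The theta function is $$\Theta_6(q):=(q;q)_\infty^3(q;q^2)_\infty^2=\frac12\sum_{n\in\mathbb Z}\chi_6(n)\,n\,q^{\frac{n^2-1}{24}},$$ where $\chi_6(n)=1$ if $n\equiv1\pmod 6$, $\chi_6(n)=-1$ if $n\equiv-1\pmod 6$, and $0$ otherwise. For integers $k\ge0$, $$A_k(q):=\sum_{0<t_1<\cdots<t_k}\frac{q^{t_1+\cdots+t_k}}{(1-q^{t_1})^2\cdots(1-q^{t_k})^2},\qquad C_k(q):=\sum_{0<t_1<\cdots<t_k}\frac{q^{2t_1+\cdots+2t_k-k}}{(1-q^{2t_1-1})^2\cdots(1-q^{2t_k-1})^2},$$ with $A_0(q)=C_0(q)=1$. *)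

theory Defs
  imports
    "HOL-Analysis.Analysis"
    "HOL-Computational_Algebra.Formal_Laurent_Series"
    "HOL-Number_Theory.Cong"
begin

text \<open>
  All series are formal power series in \<open>q\<close>, written \<open>fps_X\<close>, over the complex numbers. Infinite
  products and sums are taken in the library's metric topology on formal power series, i.e. the
  \<open>q\<close>-adic one.
\<close>

definition qpoch :: "complex fps \<Rightarrow> complex fps \<Rightarrow> complex fps" where
  "qpoch a q = (\<Prod>j. 1 - a * q ^ j)"

definition Theta6 :: "complex fps" where
  "Theta6 = qpoch fps_X fps_X ^ 3 * qpoch fps_X (fps_X ^ 2) ^ 2"

text \<open>
  A tuple \<open>0 < t\<^sub>1 < \<dots> < t\<^sub>k\<close> is represented by the \<open>k\<close>-element set of its entries. For \<open>k = 0\<close> the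
  only such set is the empty one, so that \<open>A\<^sub>0 = C\<^sub>0 = 1\<close>.
\<close>

definition ksubsets :: "nat \<Rightarrow> nat set set" where
  "ksubsets k = {T. finite T \<and> card T = k \<and> (\<forall>t\<in>T. 0 < t)}"

definition A_series :: "nat \<Rightarrow> complex fps" where
  "A_series k =
     (\<Sum>\<^sub>\<infinity>T\<in>ksubsets k. fps_X ^ (\<Sum>t\<in>T. t) / (\<Prod>t\<in>T. (1 - fps_X ^ t) ^ 2))"

text \<open>The subtractions on natural numbers below do not truncate, as all elements of \<open>T\<close> are positive.\<close>

definition C_series :: "nat \<Rightarrow> complex fps" where
  "C_series k =
     (\<Sum>\<^sub>\<infinity>T\<in>ksubsets k. fps_X ^ ((\<Sum>t\<in>T. 2 * t) - k) / (\<Prod>t\<in>T. (1 - fps_X ^ (2 * t - 1)) ^ 2))"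

definition big_O_q :: "nat \<Rightarrow> complex fps set" where
  "big_O_q m = {R. \<forall>i<m. fps_nth R i = 0}"

end

theory Submission
  imports Defs
begin

text \<open>
  In the variable \<open>x\<close> with \<open>x = 2 - z - 1/z\<close>, the generating functions of the \<open>A\<^sub>k\<close> and of the
  \<open>C\<^sub>k\<close> are theta products divided by squares of \<open>q\<close>-Pochhammer symbols. Expanding a theta product
  in Chebyshev-like polynomials in \<open>x\<close>, where the \<open>j\<close>-th one has degree \<open>j\<close> and its coefficient
  carries \<open>q\<^bsup>j(j+1)/2\<^esup>\<close> resp. \<open>q\<^bsup>j\<^sup>2\<^esup>\<close>, and reading off the coefficient of \<open>x\<^sup>k\<close>, only the term \<open>j = k\<close>
  matters to leading order:
  \<open>(q;q)\<^sup>3 A\<^sub>k = q\<^bsup>k(k+1)/2\<^esup> (1 + O(q\<^bsup>k+1\<^esup>))\<close> and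
  \<open>(q;q\<^sup>2)\<^sup>2 (q\<^sup>2;q\<^sup>2) C\<^sub>m = q\<^bsup>m\<^sup>2\<^esup> (1 + O(q\<^bsup>2m+1\<^esup>))\<close>.
  With \<open>k = n + 2j\<close> and \<open>m = n - j\<close> the exponents add up to \<open>(3n\<^sup>2 + n)/2 + (3j\<^sup>2 + j)\<close>, and the bounds
  \<open>r1\<close>, \<open>r2\<close> say exactly \<open>3j\<^sup>2 + j \<le> n\<close>. So by the pentagonal number theorem
  \<open>(q\<^sup>2;q\<^sup>2) = \<Sum>\<^sub>j (-1)\<^sup>j q\<^bsup>3j\<^sup>2+j\<^esup>\<close>, after multiplication by \<open>\<Theta>\<^sub>6 (q\<^sup>2;q\<^sup>2)\<close> the sum becomes
  \<open>q\<^bsup>(3n\<^sup>2+n)/2\<^esup> ((q\<^sup>2;q\<^sup>2) + O(q\<^bsup>n+1\<^esup>))\<close>, and \<open>\<Theta>\<^sub>6 (q\<^sup>2;q\<^sup>2)\<close> is a unit.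
\<close>

subsection \<open>Gaussian binomial coefficients\<close>

fun qbin :: "'a::comm_ring_1 \<Rightarrow> nat \<Rightarrow> nat \<Rightarrow> 'a" where
  "qbin Q n 0 = 1"
| "qbin Q 0 (Suc k) = 0"
| "qbin Q (Suc n) (Suc k) = qbin Q n k + Q ^ Suc k * qbin Q n (Suc k)"

lemma qbin_eq_0: "n < k \<Longrightarrow> qbin Q n k = 0"
  by (induction Q n k rule: qbin.induct) auto

lemma qbin_same [simp]: "qbin Q n n = 1"
  by (induction n) (auto simp: qbin_eq_0)

text \<open>The mirror image of the defining Pascal rule. After expanding both parts, the middle
  terms carry the same power \<open>Q^(n+1)\<close>, which allows the regrouping.\<close>

lemma qbin_Suc_Suc':
  "k \<le> n \<Longrightarrow> qbin Q (Suc n) (Suc k) = Q ^ (n - k) * qbin Q n k + qbin Q n (Suc k)"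
proof (induction n arbitrary: k)
  case 0
  then show ?case by simp
next
  case (Suc n)
  note [simp del] = qbin.simps(3) and rec = qbin.simps(3)
  show ?case
  proof (cases k)
    case 0
    have "qbin Q (Suc (Suc n)) (Suc 0) = 1 + Q * (Q ^ n + qbin Q n (Suc 0))"
      using Suc.IH[of 0] by (simp add: rec[of Q "Suc n"])
    also have "\<dots> = Q ^ Suc n + qbin Q (Suc n) (Suc 0)"
      by (simp add: rec[of Q n] algebra_simps)
    finally show ?thesis using 0 by simp
  next
    case (Suc k')
    show ?thesis
    proof (cases "k \<le> n")
      case True
      have *: "Q ^ Suc k * Q ^ (n - k) = Q ^ (n - k') * Q ^ k"
        unfolding power_add[symmetric] using True Suc
        by (intro arg_cong[of _ _ "power Q"]) simp
      have "qbin Q (Suc (Suc n)) (Suc k) = Q ^ (n - k') * qbin Q n k' + qbin Q n k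
             + Q ^ Suc k * (Q ^ (n - k) * qbin Q n k + qbin Q n (Suc k))"
        using Suc.IH[of k'] Suc.IH[of k] True Suc by (simp add: rec[of Q "Suc n"])
      also have "\<dots> = Q ^ (n - k') * qbin Q n k' + qbin Q n k
             + Q ^ Suc k * Q ^ (n - k) * qbin Q n k + Q ^ Suc k * qbin Q n (Suc k)"
        by (simp add: algebra_simps)
      also have "\<dots> = Q ^ (n - k') * (qbin Q n k' + Q ^ k * qbin Q n k)
             + (qbin Q n k + Q ^ Suc k * qbin Q n (Suc k))"
        unfolding * by (simp add: algebra_simps)
      also have "qbin Q n k' + Q ^ k * qbin Q n k = qbin Q (Suc n) k"
        by (simp add: rec[of Q n] Suc)
      also have "qbin Q n k + Q ^ Suc k * qbin Q n (Suc k) = qbin Q (Suc n) (Suc k)"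
        by (simp add: rec[of Q n])
      finally show ?thesis using Suc by simp
    next
      case False
      then have "k = Suc n" using Suc.prems by simp
      then show ?thesis by (simp add: qbin_eq_0)
    qed
  qed
qed

text \<open>Reflecting \<open>k\<close> to \<open>n - k\<close> exchanges the two Pascal
  rules.\<close>

lemma qbin_symmetric: "k \<le> n \<Longrightarrow> qbin Q n (n - k) = qbin Q n k"
proof (induction n arbitrary: k)
  case (Suc n)
  show ?case
  proof (cases k)
    case (Suc k')
    have k': "k' \<le> n" using Suc Suc.prems by simp
    have sym1: "qbin Q n (n - k') = qbin Q n k'"
      using Suc.IH k' by simp
    show ?thesis
    proof (cases "n = k'")
      case False
      then obtain m where m: "n - k' = Suc m" and m': "m = n - Suc k'"
        using k' by (metis Suc_diff_Suc le_neq_implies_less)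
      have "qbin Q (Suc n) (Suc m) = Q ^ (n - m) * qbin Q n m + qbin Q n (n - k')"
        using qbin_Suc_Suc'[of m n Q] m by simp
      also have "qbin Q n m = qbin Q n (Suc k')"
        using Suc.IH[of "Suc k'"] m' False k' by simp
      also have "n - m = Suc k'" using m m' k' by simp
      finally have "qbin Q (Suc n) (Suc m) = qbin Q n k' + Q ^ Suc k' * qbin Q n (Suc k')"
        using sym1 by (simp add: add.commute)
      then show ?thesis using Suc m by simp
    qed (use Suc in \<open>simp add: qbin_eq_0\<close>)
  qed (simp del: qbin.simps(3))
qed simp

definition qfact :: "'a::comm_ring_1 \<Rightarrow> nat \<Rightarrow> 'a" where
  "qfact Q n = (\<Prod>i<n. 1 - Q ^ Suc i)"

lemma qfact_0 [simp]: "qfact Q 0 = 1"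
  and qfact_Suc: "qfact Q (Suc n) = qfact Q n * (1 - Q ^ Suc n)"
  by (simp_all add: qfact_def)

text \<open>The parts of the Pascal rule contribute \<open>qfact Q n\<close> times
  \<open>1 - Q^(k'+1)\<close> and times \<open>Q^(k'+1) (1 - Q^(m+1))\<close>; these factors add up
  to \<open>1 - Q^(n+1)\<close>.\<close>

lemma qbin_qfact: "k \<le> n \<Longrightarrow> qbin Q n k * (qfact Q k * qfact Q (n - k)) = qfact Q n"
proof (induction n arbitrary: k)
  case (Suc n)
  show ?case
  proof (cases k)
    case (Suc k')
    have k': "k' \<le> n" using Suc Suc.prems by simp
    have 1: "qbin Q n k' * (qfact Q k' * qfact Q (n - k')) = qfact Q n"
      using Suc.IH k' by simp
    show ?thesis
    proof (cases "n = k'")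
      case True
      then show ?thesis using Suc by simp
    next
      case False
      then obtain m where m: "n - k' = Suc m" and m': "m = n - Suc k'"
        using k' by (metis Suc_diff_Suc le_neq_implies_less)
      have 2: "qbin Q n (Suc k') * (qfact Q (Suc k') * qfact Q m) = qfact Q n"
        using Suc.IH[of "Suc k'"] m' k' False by simp
      have *: "Q ^ Suc k' * Q ^ Suc m = Q ^ Suc n"
        unfolding power_add[symmetric] using m by (intro arg_cong[of _ _ "power Q"]) simp
      have "qbin Q (Suc n) k * (qfact Q k * qfact Q (Suc n - k))
          = qbin Q n k' * (qfact Q k' * qfact Q (n - k')) * (1 - Q ^ Suc k') +
            qbin Q n (Suc k') * (qfact Q (Suc k') * qfact Q m) * (Q ^ Suc k' * (1 - Q ^ Suc m))"
        by (simp only: Suc m diff_Suc_Suc qbin.simps qfact_Suc) (simp only: algebra_simps)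
      also have "\<dots> = qfact Q n * (1 - Q ^ Suc k' * Q ^ Suc m)"
        unfolding 1 2 by (simp add: algebra_simps)
      finally show ?thesis by (simp only: * qfact_Suc)
    qed
  qed simp
qed simp

subsection \<open>A finite theta product\<close>

text \<open>
  At \<open>x = 2 - z - 1/z\<close>, \<open>cheb 1 j\<close> is \<open>z\<^sup>j + z\<^bsup>j-1\<^esup> + \<dots> + z\<^bsup>-j\<^esup>\<close>, and \<open>cheb 0 j\<close> is \<open>z\<^sup>j + z\<^bsup>-j\<^esup>\<close>
  for \<open>j > 0\<close>, but \<open>1\<close> for \<open>j = 0\<close>.
\<close>

fun cheb :: "nat \<Rightarrow> nat \<Rightarrow> 'a::comm_ring_1 poly" where
  "cheb d 0 = 1"
| "cheb d (Suc 0) = [:2 + of_nat d, -1:]"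
| "cheb d (Suc (Suc j)) =
     [:2, -1:] * cheb d (Suc j) - smult (if j = 0 then 2 - of_nat d else 1) (cheb d j)"

text \<open>Each factor \<open>2 - x\<close> raises the degree by one and flips the leading sign.
  This triangularity later isolates the term \<open>j = k\<close>.\<close>

lemma coeff_cheb:
  "(\<forall>k>j. coeff (cheb d j :: 'a::comm_ring_1 poly) k = 0) \<and> coeff (cheb d j :: 'a poly) j = (-1) ^ j"
proof (induction d j rule: cheb.induct)
  case (2 d)
  have "coeff [:2 + of_nat d, -1:: 'a:] k = 0" if "k > Suc 0" for k
    using that by (cases k; cases "k - 1") auto
  then show ?case by simp
next
  case (3 d j)
  then show ?case by (auto simp: coeff_pCons split: nat.splits)
qed auto

lemma coeff_cheb_less: "j < k \<Longrightarrow> coeff (cheb d j) k = 0"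
  and coeff_cheb_same: "coeff (cheb d j) j = (-1) ^ j"
  using coeff_cheb by blast+

text \<open>Since \<open>2 - x = z + 1/z\<close>, multiplication moves indices one up and one down.
  The exception at 0 comes from \<open>(2 - x) * cheb d 0 = cheb d 1 - d * cheb d 0\<close> and the
  factor \<open>2 - d\<close> in the recursion for \<open>cheb d 2\<close>.\<close>

lemma mult_sum_cheb:
  fixes a :: "nat \<Rightarrow> 'a::comm_ring_1"
  assumes "\<And>j. N < j \<Longrightarrow> a j = 0"
  shows "[:2, -1:] * (\<Sum>j\<le>N. smult (a j) (cheb d j)) =
    (\<Sum>j\<le>Suc N. smult (case j of 0 \<Rightarrow> (2 - of_nat d) * a 1 - of_nat d * a 0
                       | Suc i \<Rightarrow> a i + a (Suc (Suc i))) (cheb d j))"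
    (is "_ = (\<Sum>j\<le>Suc N. smult (?L j) _)")
proof -
  \<comment> \<open>Cutting the sum at an arbitrary \<open>M\<close> leaves two overflowing top
    terms, kept explicit so that the induction closes.\<close>
  have *: "[:2, -1:] * (\<Sum>j\<le>Suc M. smult (a j) (cheb d j)) =
     (\<Sum>j\<le>M. smult (?L j) (cheb d j)) + smult (a M) (cheb d (Suc M)) +
     smult (a (Suc M)) (cheb d (Suc (Suc M)))" for M
  proof (induction M)
    case 0
    show ?case by (simp add: algebra_simps smult_add_left)
  next
    case (Suc M)
    have "[:2, -1:] * (\<Sum>j\<le>Suc (Suc M). smult (a j) (cheb d j)) =
       [:2, -1:] * (\<Sum>j\<le>Suc M. smult (a j) (cheb d j)) +
       smult (a (Suc (Suc M))) ([:2, -1:] * cheb d (Suc (Suc M)))"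
      by (simp add: distrib_left del: cheb.simps)
    also have "[:2, -1:] * cheb d (Suc (Suc M)) =
        (cheb d (Suc (Suc (Suc M))) + cheb d (Suc M) :: 'a poly)"
      by simp
    finally show ?case unfolding Suc.IH by (simp add: smult_add_left smult_add_right del: cheb.simps)
  qed
  have "(\<Sum>j\<le>Suc N. smult (a j) (cheb d j)) = (\<Sum>j\<le>N. smult (a j) (cheb d j))"
    using assms by simp
  with *[of N] show ?thesis using assms by (simp del: cheb.simps)
qed

text \<open>
  The weights are \<open>q\<^sup>t\<close> (for \<open>A\<close>: \<open>d = 1\<close>, \<open>p = Q = q\<close>) and \<open>q\<^bsup>2t-1\<^esup>\<close> (for \<open>C\<close>: \<open>d = 0\<close>, \<open>p = q\<close>,
  \<open>Q = q\<^sup>2\<close>), with \<open>t = i + 1\<close>.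
\<close>

definition wt :: "'a::comm_ring_1 \<Rightarrow> 'a \<Rightarrow> nat \<Rightarrow> 'a" where
  "wt p Q i = p * Q ^ i"

text \<open>A finite Jacobi triple product: for \<open>x = 2 - z - 1/z\<close> the factor
  \<open>(1 - w)^2 + w x\<close> is \<open>(1 - w z)(1 - w/z)\<close>. Passing from \<open>N\<close>
  to \<open>N + 1\<close> amounts to applying both Pascal rules.\<close>

lemma finite_theta:
  fixes p Q :: "'a::comm_ring_1"
  assumes d: "d = 0 \<and> p\<^sup>2 = Q \<or> d = 1 \<and> p = Q"
  shows "(\<Prod>i<N. [:(1 - wt p Q i)\<^sup>2, wt p Q i:]) =
    (\<Sum>j\<le>N. smult ((-1) ^ j * (\<Prod>i<j. wt p Q i) * qbin Q (2 * N + d) (N + d + j)) (cheb d j))"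
proof (induction N)
  case 0
  show ?case by simp
next
  case (Suc N)
  let ?W = "\<lambda>j. \<Prod>i<j. wt p Q i"
  define M where "M = 2 * N + d"
  define c where "c j = qbin Q M (N + d + j)" for j
  define a where "a j = (-1) ^ j * ?W j * c j" for j
  define v where "v = wt p Q N"
  define L where "L j = (case j of 0 \<Rightarrow> (2 - of_nat d) * a 1 - of_nat d * a 0
                       | Suc i \<Rightarrow> a i + a (Suc (Suc i)))" for j
  have a0: "a j = 0" if "j > N" for j
    using that by (simp add: a_def c_def M_def qbin_eq_0)
  \<comment> \<open>In both cases \<open>p^2 = Q^(d+1)\<close>, so a product of two weights is a
    power of \<open>Q\<close> depending only on the sum of the indices.\<close>
  have ww: "wt p Q i * wt p Q j = Q ^ (i + j + Suc d)" for i j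
  proof -
    have "p * p = Q ^ Suc d" using d by (auto simp: power2_eq_square)
    moreover have "wt p Q i * wt p Q j = (p * p) * (Q ^ i * Q ^ j)"
      by (simp add: wt_def mult_ac)
    ultimately show ?thesis by (simp only: power_add mult_ac)
  qed
  \<comment> \<open>Raising \<open>N\<close> by one raises the upper index by two: one Pascal rule
    is applied first, then its mirror image to each part. At \<open>N + d + j = 0\<close> there is
    no left neighbour.\<close>
  have two_step: "qbin Q (Suc (Suc M)) (Suc (N + d + j)) =
      (if N + d + j = 0 then 1 + Q ^ Suc M else
       (1 + Q ^ Suc M) * c j + Q ^ Suc (N + d + j) * c (Suc j) +
       Q ^ (Suc M - (N + d + j)) * qbin Q M (N + d + j - 1))" if "j \<le> Suc N" for j
  proof (cases "N + d + j")
    case 0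
    then show ?thesis by (simp add: M_def)
  next
    case (Suc k)
    have le: "k \<le> M" using Suc that by (simp add: M_def)
    have "qbin Q (Suc (Suc M)) (Suc (Suc k)) =
      (Q ^ (M - k) * qbin Q M k + qbin Q M (Suc k)) +
      Q ^ Suc (Suc k) * (if Suc k \<le> M then Q ^ (M - Suc k) * qbin Q M (Suc k) + qbin Q M (Suc (Suc k))
         else 0)"
      using qbin_Suc_Suc'[OF le, of Q] qbin_Suc_Suc'[of "Suc k" M Q] le
        by (auto simp: qbin.simps(3)[of Q "Suc M"] qbin_eq_0 simp del: qbin.simps(3))
    also have "Q ^ Suc (Suc k) * (if Suc k \<le> M then Q ^ (M - Suc k) * qbin Q M (Suc k) + qbin Q M (Suc (Suc k))
         else 0) = Q ^ Suc M * qbin Q M (Suc k) + Q ^ Suc (Suc k) * qbin Q M (Suc (Suc k))"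
    proof (cases "Suc k \<le> M")
      case True
      have "Q ^ Suc (Suc k) * Q ^ (M - Suc k) = Q ^ Suc M"
        using True by (simp flip: power_add power_Suc)
      then show ?thesis using True by (simp only: distrib_left mult.assoc[symmetric] if_True)
    qed (use le in \<open>simp add: qbin_eq_0\<close>)
    finally show ?thesis using Suc by (simp add: c_def algebra_simps)
  qed
  have step: "(1 + v\<^sup>2) * a j - v * L j =
      (-1) ^ j * ?W j * qbin Q (Suc (Suc M)) (Suc (N + d + j))" if j: "j \<le> Suc N" for j
  proof (cases j)
    case 0
    have v2: "v\<^sup>2 = Q ^ Suc M" using ww[of N N] by (simp add: v_def M_def power2_eq_square mult_2)
    have vw: "v * wt p Q 0 = Q ^ (N + Suc d)" using ww[of N 0] by (simp add: v_def)
    \<comment> \<open>At the centre, \<open>two_step\<close> involves the left neighbour (if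
      \<open>N + d > 0\<close>). Symmetry folds it onto \<open>c 0\<close> for \<open>d = 1\<close>
      and onto \<open>c 1\<close> for \<open>d = 0\<close>, matching the exceptional value
      \<open>L 0\<close>.\<close>
    show ?thesis
    proof (cases "d = 0")
      case False
      then have d1: "d = 1" and "p = Q" using d by auto
      then have v: "v = Q ^ Suc N" by (simp add: v_def wt_def)
      have "qbin Q M N = c 0" using qbin_symmetric[of N M Q] by (simp add: M_def c_def d1)
      then have "qbin Q (Suc (Suc M)) (Suc (N + d + 0)) =
          (1 + v\<^sup>2) * c 0 + (v * wt p Q 0) * c 1 + Q ^ Suc N * c 0"
        using two_step[of 0] unfolding v2 vw by (simp add: M_def d1 del: qbin.simps(3))
      then show ?thesis unfolding v[symmetric] using 0
        by (simp add: L_def a_def d1 algebra_simps del: qbin.simps(3))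
    next
      case True
      have "qbin Q (Suc (Suc M)) (Suc (N + d + 0)) =
          (1 + v\<^sup>2) * c 0 + 2 * ((v * wt p Q 0) * c 1)"
      proof (cases "N = 0")
        case True
        then show ?thesis using two_step[of 0] \<open>d = 0\<close> unfolding v2 by (simp add: c_def M_def)
      next
        case False
        have "qbin Q M (N - 1) = c 1"
          using qbin_symmetric[of "N - 1" M Q] False True by (simp add: M_def c_def mult_2)
        moreover have "Suc M - (N + d + 0) = Suc N" using True by (simp add: M_def)
        ultimately have "qbin Q (Suc (Suc M)) (Suc (N + d + 0)) =
            (1 + Q ^ Suc M) * c 0 + Q ^ Suc N * c 1 + Q ^ Suc N * c 1"
          using two_step[of 0] False True by (simp only: le0) simp
        then show ?thesis unfolding v2 vw True by (simp only: add_0_right One_nat_def add_Suc_right mult_2 add.assoc)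
      qed
      then show ?thesis using 0 by (simp add: L_def a_def True algebra_simps del: qbin.simps(3))
    qed
  next
    case (Suc i)
    have v2: "v\<^sup>2 = Q ^ Suc M" using ww[of N N] by (simp add: v_def M_def power2_eq_square mult_2)
    have vw: "v * wt p Q j = Q ^ Suc (N + d + j)" using ww[of N j] by (simp add: v_def add_ac)
    have vi: "v = wt p Q i * Q ^ (N - i)"
      using j Suc by (simp add: v_def wt_def mult.assoc flip: power_add)
    have "qbin Q (Suc (Suc M)) (Suc (N + d + j)) =
       (1 + v\<^sup>2) * c j + (v * wt p Q j) * c (Suc j) + Q ^ (N - i) * c i"
      unfolding two_step[OF j] v2 vw using j Suc by (simp add: M_def c_def)
    moreover have "v * a i = (-1) ^ i * ?W j * (Q ^ (N - i) * c i)"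
      unfolding vi by (simp add: a_def Suc mult_ac)
    moreover have "v * a (Suc j) = (-1) ^ i * ?W j * (v * wt p Q j * c (Suc j))"
      by (simp add: a_def Suc mult_ac)
    ultimately show ?thesis
      unfolding L_def by (simp add: Suc a_def algebra_simps)
  qed
  have smult_sum': "smult x (sum f A) = (\<Sum>i\<in>A. smult x (f i))" for x and f :: "nat \<Rightarrow> 'a poly" and A
    by (induction A rule: infinite_finite_induct) (simp_all add: smult_add_right)
  have "(\<Prod>i<Suc N. [:(1 - wt p Q i)\<^sup>2, wt p Q i:]) =
      (\<Sum>j\<le>N. smult (a j) (cheb d j)) * [:(1 - v)\<^sup>2, v:]"
    unfolding a_def c_def M_def v_def by (simp add: Suc.IH)
  \<comment> \<open>In this form the new factor acts on the expansion only through
    \<open>2 - x\<close>, as in \<open>mult_sum_cheb\<close>.\<close>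
  also have "[:(1 - v)\<^sup>2, v:] = [:1 + v\<^sup>2:] - smult v [:2, -1:]"
    by (simp add: power2_eq_square algebra_simps)
  also have "(\<Sum>j\<le>N. smult (a j) (cheb d j)) * ([:1 + v\<^sup>2:] - smult v [:2, -1:]) =
     smult (1 + v\<^sup>2) (\<Sum>j\<le>N. smult (a j) (cheb d j)) -
     smult v ([:2, -1:] * (\<Sum>j\<le>N. smult (a j) (cheb d j)))"
    by (simp only: right_diff_distrib mult_smult_right mult.commute[of _ "[:1 + v\<^sup>2:]"]
        mult.commute[of _ "[:2, -1:]"] mult_pCons_left mult_zero_left pCons_0_0 add_0_right)
  also have "[:2, -1:] * (\<Sum>j\<le>N. smult (a j) (cheb d j)) = (\<Sum>j\<le>Suc N. smult (L j) (cheb d j))"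
    unfolding L_def by (rule mult_sum_cheb) (rule a0)
  also have "(\<Sum>j\<le>N. smult (a j) (cheb d j)) = (\<Sum>j\<le>Suc N. smult (a j) (cheb d j))"
    by (simp add: a0)
  also have "smult (1 + v\<^sup>2) (\<Sum>j\<le>Suc N. smult (a j) (cheb d j)) -
     smult v (\<Sum>j\<le>Suc N. smult (L j) (cheb d j)) =
     (\<Sum>j\<le>Suc N. smult ((1 + v\<^sup>2) * a j - v * L j) (cheb d j))"
    by (simp only: smult_sum' sum_subtractf[symmetric] smult_smult smult_diff_left)
  also have "\<dots> = (\<Sum>j\<le>Suc N. smult ((-1) ^ j * ?W j * qbin Q (Suc (Suc M)) (Suc (N + d + j))) (cheb d j))"
    by (intro sum.cong refl) (simp only: step atMost_iff)
  finally show ?case by (simp add: M_def del: sum.atMost_Suc)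
qed

text \<open>\<open>T\<close> records the factors that supply \<open>x\<close>. This links the theta
  product to sums over \<open>k\<close>-element sets.\<close>

lemma coeff_prod_linear:
  fixes b c :: "'i \<Rightarrow> 'a::comm_ring_1"
  assumes "finite I"
  shows "coeff (\<Prod>i\<in>I. [:b i, c i:]) k =
    (\<Sum>T | T \<subseteq> I \<and> card T = k. (\<Prod>i\<in>T. c i) * (\<Prod>i\<in>I-T. b i))"
proof -
  have monom: "(\<Prod>i\<in>T. monom (c i) (Suc 0)) = monom (\<Prod>i\<in>T. c i) (card T)" if "finite T" for T
    using that by induction (auto simp: monom_0 mult_monom)
  have const: "(\<Prod>i\<in>T. [:b i:]) = [:\<Prod>i\<in>T. b i:]" if "finite T" for T
    using that by induction auto
  have "(\<Prod>i\<in>I. [:b i, c i:]) = (\<Prod>i\<in>I. monom (c i) (Suc 0) + [:b i:])"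
    by (simp add: monom_Suc monom_0)
  also have "\<dots> = (\<Sum>T\<in>Pow I. (\<Prod>i\<in>T. monom (c i) (Suc 0)) * (\<Prod>i\<in>I-T. [:b i:]))"
    by (rule prod_add[OF assms])
  also have "\<dots> = (\<Sum>T\<in>Pow I. monom ((\<Prod>i\<in>T. c i) * (\<Prod>i\<in>I-T. b i)) (card T))"
    using assms by (intro sum.cong refl)
      (auto simp: monom const finite_subset smult_monom mult.commute)
  finally have "coeff (\<Prod>i\<in>I. [:b i, c i:]) k =
      (\<Sum>T\<in>Pow I. if card T = k then (\<Prod>i\<in>T. c i) * (\<Prod>i\<in>I-T. b i) else 0)"
    by (simp add: coeff_sum)
  also have "\<dots> = (\<Sum>T | T \<subseteq> I \<and> card T = k. (\<Prod>i\<in>T. c i) * (\<Prod>i\<in>I-T. b i))"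
    using assms by (intro sum.mono_neutral_cong_right) auto
  finally show ?thesis .
qed

text \<open>Terms \<open>j < k\<close> have too small a degree, the two signs cancel at
  \<open>j = k\<close>, and for \<open>j > k\<close> the product of weights already contains the
  first \<open>k + 1\<close> weights.\<close>

lemma finite_theta_coeff:
  fixes p Q :: "'a::comm_ring_1"
  assumes d: "d = 0 \<and> p\<^sup>2 = Q \<or> d = 1 \<and> p = Q" and "k \<le> N"
  shows "(\<Prod>i<Suc k. wt p Q i) dvd
    (\<Sum>T | T \<subseteq> {..<N} \<and> card T = k. (\<Prod>i\<in>T. wt p Q i) * (\<Prod>i\<in>{..<N}-T. (1 - wt p Q i)\<^sup>2)) -
    (\<Prod>i<k. wt p Q i) * qbin Q (2 * N + d) (N + d + k)"
proof -
  define g where "g j = (-1) ^ j * (\<Prod>i<j. wt p Q i) * qbin Q (2 * N + d) (N + d + j) * coeff (cheb d j) k" for j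
  have "(\<Sum>T | T \<subseteq> {..<N} \<and> card T = k. (\<Prod>i\<in>T. wt p Q i) * (\<Prod>i\<in>{..<N}-T. (1 - wt p Q i)\<^sup>2))
      = (\<Sum>j\<le>N. g j)"
    unfolding g_def coeff_prod_linear[OF finite_lessThan, symmetric] finite_theta[OF d]
    by (simp add: coeff_sum)
  also have "\<dots> = (\<Sum>j\<in>{k..N}. g j)"
    by (intro sum.mono_neutral_right) (auto simp: g_def coeff_cheb_less)
  also have "\<dots> = g k + (\<Sum>j\<in>{Suc k..N}. g j)"
    using \<open>k \<le> N\<close> by (simp add: sum.atLeast_Suc_atMost)
  also have "g k = (\<Prod>i<k. wt p Q i) * qbin Q (2 * N + d) (N + d + k)"
    by (simp add: g_def coeff_cheb_same mult_ac flip: power_mult_distrib)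
  finally have eq: "(\<Sum>T | T \<subseteq> {..<N} \<and> card T = k. (\<Prod>i\<in>T. wt p Q i) * (\<Prod>i\<in>{..<N}-T. (1 - wt p Q i)\<^sup>2)) -
    (\<Prod>i<k. wt p Q i) * qbin Q (2 * N + d) (N + d + k) = (\<Sum>j\<in>{Suc k..N}. g j)"
    by simp
  have "(\<Prod>i<Suc k. wt p Q i) dvd g j" if "j \<in> {Suc k..N}" for j
  proof -
    have "(\<Prod>i<Suc k. wt p Q i) dvd (\<Prod>i<j. wt p Q i)"
      using that by (intro prod_dvd_prod_subset) auto
    then show ?thesis unfolding g_def by (intro dvd_mult2 dvd_mult)
  qed
  then show ?thesis unfolding eq by (rule dvd_sum)
qed

subsection \<open>Congruence of power series modulo powers of the variable\<close>

definition fps_cong :: "nat \<Rightarrow> 'a::comm_ring_1 fps \<Rightarrow> 'a fps \<Rightarrow> bool" where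
  "fps_cong m f g \<longleftrightarrow> fps_X ^ m dvd f - g"

lemma fps_X_power_dvd_iff: "fps_X ^ m dvd (f :: 'a::comm_ring_1 fps) \<longleftrightarrow> (\<forall>i<m. fps_nth f i = 0)"
proof
  assume *: "\<forall>i<m. fps_nth f i = 0"
  have "fps_cutoff m f = 0" using * by (auto simp: fps_eq_iff)
  then have "f = fps_X ^ m * fps_shift m f"
    using fps_shift_cutoff'[of m f] by simp
  then show "fps_X ^ m dvd f" by (metis dvd_triv_left)
qed (auto simp: fps_X_power_mult_nth elim!: dvdE)

lemma fps_cong_iff: "fps_cong m f g \<longleftrightarrow> (\<forall>i<m. fps_nth f i = fps_nth g i)"
  by (simp add: fps_cong_def fps_X_power_dvd_iff)

lemma fps_cong_refl [simp]: "fps_cong m f f"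
  and fps_cong_sym: "fps_cong m f g \<Longrightarrow> fps_cong m g f"
  and fps_cong_trans [trans]: "fps_cong m f g \<Longrightarrow> fps_cong m g h \<Longrightarrow> fps_cong m f h"
  and fps_cong_mono: "fps_cong m f g \<Longrightarrow> m' \<le> m \<Longrightarrow> fps_cong m' f g"
  by (auto simp: fps_cong_iff)

lemma fps_cong_mult: "fps_cong m f g \<Longrightarrow> fps_cong m f' g' \<Longrightarrow> fps_cong m (f * f') (g * g')"
proof -
  assume "fps_cong m f g" "fps_cong m f' g'"
  then have "fps_X ^ m dvd (f - g) * f' + g * (f' - g')"
    unfolding fps_cong_def by (intro dvd_add dvd_mult dvd_mult2)
  then show ?thesis by (simp add: fps_cong_def algebra_simps)
qed

lemma fps_cong_power: "fps_cong m f g \<Longrightarrow> fps_cong m (f ^ n) (g ^ n)"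
  by (induction n) (auto intro: fps_cong_mult)

lemma fps_cong_sum: "(\<And>i. i \<in> I \<Longrightarrow> fps_cong m (f i) (g i)) \<Longrightarrow> fps_cong m (sum f I) (sum g I)"
  by (auto simp: fps_cong_iff fps_sum_nth)

section \<open>Infinite products and sums modulo powers of the variable\<close>

lemma fps_cong_limit:
  fixes S :: "nat \<Rightarrow> 'a::comm_ring_1 fps"
  assumes "\<And>n. fps_cong (Suc n) (S n) (S (Suc n))"
  obtains L where "\<And>n. fps_cong (Suc n) (S n) L"
proof
  have *: "fps_cong (Suc n) (S n) (S (n + k))" for n k
  proof (induction k)
    case (Suc k)
    have "fps_cong (Suc n) (S (n + k)) (S (n + Suc k))"
      using assms[of "n + k"] by (auto intro: fps_cong_mono)
    with Suc show ?case by (rule fps_cong_trans)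
  qed simp
  \<comment> \<open>The limit is the diagonal: coefficient \<open>i\<close> no longer changes from
    \<open>S i\<close> on.\<close>
  show "fps_cong (Suc n) (S n) (Abs_fps (\<lambda>i. fps_nth (S i) i))" for n
    unfolding fps_cong_iff
  proof (intro allI impI)
    fix i assume "i < Suc n"
    then have "fps_nth (S i) i = fps_nth (S (i + (n - i))) i"
      using *[of i "n - i"] unfolding fps_cong_iff by blast
    then show "fps_nth (S n) i = fps_nth (Abs_fps (\<lambda>i. fps_nth (S i) i)) i"
      using \<open>i < Suc n\<close> by simp
  qed
qed

lemma prodinf_fps_cong:
  fixes f :: "nat \<Rightarrow> complex fps"
  assumes f: "\<And>i. fps_cong (Suc i) (f i) 1"
  shows "fps_cong N (prodinf f) (\<Prod>i<N. f i)"
proof -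
  have step: "fps_cong (Suc n) (\<Prod>i<Suc n. f i) (\<Prod>i<Suc (Suc n). f i)" for n
  proof -
    have "fps_cong (Suc n) ((\<Prod>i<Suc n. f i) * 1) ((\<Prod>i<Suc n. f i) * f (Suc n))"
      using fps_cong_mono[OF fps_cong_sym[OF f[of "Suc n"]], of "Suc n"] by (intro fps_cong_mult) simp_all
    then show ?thesis by simp
  qed
  obtain L where L: "\<And>n. fps_cong (Suc n) (\<Prod>i<Suc n. f i) L"
    using fps_cong_limit[of "\<lambda>n. \<Prod>i<Suc n. f i"] step by blast
  \<comment> \<open>\<open>has_prod\<close> demands a nonzero limit of the partial products; the
    constant term guarantees it.\<close>
  have "fps_nth L 0 = 1"
    using L[of 0] f[of 0] by (auto simp: fps_cong_iff)
  then have "L \<noteq> 0" by auto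
  moreover have "(\<lambda>n. \<Prod>i\<le>n. f i) \<longlonglongrightarrow> L"
    unfolding tendsto_fps_iff
  proof
    fix k
    show "eventually (\<lambda>n. fps_nth (\<Prod>i\<le>n. f i) k = fps_nth L k) sequentially"
      using eventually_ge_at_top[of k]
    proof eventually_elim
      case (elim n)
      then show ?case using L[of n] by (simp add: fps_cong_iff lessThan_Suc_atMost)
    qed
  qed
  ultimately have "f has_prod L" by (simp add: has_prod_def raw_has_prod_def)
  then have "prodinf f = L" by (rule has_prod_unique[symmetric])
  then show ?thesis
    using fps_cong_sym[OF L[of "N - 1"]] by (cases N) (simp_all add: fps_cong_iff)
qed

text \<open>A set with an element above \<open>N\<close> contributes a multiple of
  \<open>X^(N+1)\<close>. Summability is established on the way, so \<open>infsum\<close> is the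
  true limit and not its default value 0.\<close>

lemma infsum_ksubsets_fps_cong:
  fixes a :: "nat \<Rightarrow> complex fps"
  assumes a: "\<And>t. t > 0 \<Longrightarrow> fps_X ^ t dvd a t"
  shows "fps_cong (Suc N) (\<Sum>\<^sub>\<infinity>T\<in>ksubsets k. \<Prod>t\<in>T. a t) (\<Sum>T | T \<subseteq> {1..N} \<and> card T = k. \<Prod>t\<in>T. a t)"
proof -
  define f where "f T = (\<Prod>t\<in>T. a t)" for T
  define S where "S N = (\<Sum>T | T \<subseteq> {1..N} \<and> card T = k. f T)" for N
  have big: "fps_cong (Suc n) (f T) 0" if "T \<in> ksubsets k" "\<not> T \<subseteq> {1..n}" for T n
  proof -
    from that obtain t where t: "t \<in> T" "n < t" "t > 0" "finite T"
      by (force simp: ksubsets_def)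
    have "fps_X ^ Suc n dvd (fps_X ^ t :: complex fps)"
      using t by (intro le_imp_power_dvd) simp
    also have "\<dots> dvd a t" using a t by simp
    also have "\<dots> dvd f T" unfolding f_def using t by (intro dvd_prodI) auto
    finally show ?thesis by (simp add: fps_cong_def)
  qed
  have fin: "fps_cong (Suc n) (sum f F) (S n)"
    if "finite F" "F \<subseteq> ksubsets k" "{T. T \<subseteq> {1..n} \<and> card T = k} \<subseteq> F" for F n
  proof -
    have "sum f F = S n + sum f (F - {T. T \<subseteq> {1..n} \<and> card T = k})"
      unfolding S_def using that by (simp add: sum.subset_diff add.commute)
    moreover have "fps_cong (Suc n) (sum f (F - {T. T \<subseteq> {1..n} \<and> card T = k})) (sum (\<lambda>_. 0) (F - {T. T \<subseteq> {1..n} \<and> card T = k}))"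
      using that by (intro fps_cong_sum big) (auto simp: ksubsets_def)
    ultimately show ?thesis by (simp add: fps_cong_iff)
  qed
  have sub: "{T. T \<subseteq> {1..n} \<and> card T = k} \<subseteq> ksubsets k" for n
    by (auto simp: ksubsets_def intro: finite_subset)
  have finS: "finite {T. T \<subseteq> {1..n} \<and> card T = k}" for n :: nat
    by (rule finite_subset[of _ "Pow {1..n}"]) auto
  have "fps_cong (Suc n) (S n) (S (Suc n))" for n
  proof -
    have "{T. T \<subseteq> {1..n} \<and> card T = k} \<subseteq> {T. T \<subseteq> {1..Suc n} \<and> card T = k}"
      using atLeastatMost_subset_iff[of 1 n 1 "Suc n"] by auto
    from fin[OF finS sub this] show ?thesis
      unfolding S_def[of "Suc n"] by (rule fps_cong_sym)
  qed
  then obtain L where L: "\<And>n. fps_cong (Suc n) (S n) L"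
    using fps_cong_limit by blast
  have "(f has_sum L) (ksubsets k)"
    unfolding has_sum_def tendsto_fps_iff
  proof
    fix n
    have "eventually (\<lambda>F. finite F \<and> {T. T \<subseteq> {1..n} \<and> card T = k} \<subseteq> F \<and> F \<subseteq> ksubsets k)
        (finite_subsets_at_top (ksubsets k))"
      unfolding eventually_finite_subsets_at_top using finS[of n] sub[of n]
      by (intro exI[of _ "{T. T \<subseteq> {1..n} \<and> card T = k}"]) simp
    then show "eventually (\<lambda>F. fps_nth (sum f F) n = fps_nth L n) (finite_subsets_at_top (ksubsets k))"
    proof eventually_elim
      case (elim F)
      then have "fps_cong (Suc n) (sum f F) L"
        by (intro fps_cong_trans[OF fin L]) simp_all
      then show ?case by (simp add: fps_cong_iff)
    qed
  qed
  then have "infsum f (ksubsets k) = L" by (rule infsumI)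
  then show ?thesis using fps_cong_sym[OF L[of N]] unfolding f_def S_def by simp
qed


subsection \<open>The pentagonal number theorem\<close>

text \<open>Shanks' finite form: the difference of the left-hand sides for \<open>N + 1\<close> and \<open>N\<close> telescopes.\<close>

lemma pentagonal_finite:
  fixes q :: "'a::comm_ring_1"
  shows "(\<Sum>s\<le>N. (-1) ^ s * (\<Prod>i\<in>{s..<N}. 1 - q ^ Suc i) * q ^ (s * N + \<Sum>{..s})) =
     1 + (\<Sum>j=1..N. (-1) ^ j * (q ^ (j * (j - 1) + \<Sum>{..j}) + q ^ (j * j + \<Sum>{..j})))"
proof (induction N)
  case (Suc N)
  define R where "R s = (\<Prod>i\<in>{s..<N}. 1 - q ^ Suc i)" for s
  define T where "T s = (-1) ^ s * R s * q ^ (s * N + \<Sum>{..s})" for s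
  define T' where "T' s = (-1) ^ s * (\<Prod>i\<in>{s..<Suc N}. 1 - q ^ Suc i) * q ^ (s * Suc N + \<Sum>{..s})" for s
  \<comment> \<open>The telescoping witness:
    \<open>q^s (1 - q^(N+1)) - 1 = -q^(s+N+1) - (1 - q^s)\<close>, where the two parts belong to
    \<open>H (Suc s)\<close> and \<open>- H s\<close>, and \<open>1 - q^s\<close> completes
    \<open>R s\<close> to \<open>R (s - 1)\<close>. At \<open>s = 0\<close> that factor vanishes,
    hence \<open>H 0 = 0\<close>.\<close>
  define H where "H s = (if s = 0 then 0 else (-1) ^ s * R (s - 1) * q ^ (s * N + \<Sum>{..s}))" for s
  have step: "T' s = T s + (H (Suc s) - H s)" if "s \<le> N" for s
  proof -
    have R': "(\<Prod>i\<in>{s..<Suc N}. 1 - q ^ Suc i) = R s * (1 - q ^ Suc N)"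
      using that by (simp add: R_def)
    have e1: "q ^ (s * Suc N + \<Sum>{..s}) = q ^ (s * N + \<Sum>{..s}) * q ^ s"
      by (simp add: power_add algebra_simps)
    have e2: "q ^ (Suc s * N + \<Sum>{..Suc s}) = q ^ (s * N + \<Sum>{..s}) * (q ^ s * q ^ Suc N)"
      by (simp add: power_add algebra_simps)
    have e3: "H s = (-1) ^ s * (R s * (1 - q ^ s)) * q ^ (s * N + \<Sum>{..s})"
    proof (cases s)
      case (Suc s')
      have "R s' = R s * (1 - q ^ s)"
        using that Suc unfolding R_def by (subst prod.atLeast_Suc_lessThan) (auto simp: mult.commute)
      then show ?thesis by (simp add: H_def Suc)
    qed (simp add: H_def)
    have e4: "H (Suc s) = - ((-1) ^ s * R s * q ^ (Suc s * N + \<Sum>{..Suc s}))"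
      by (simp add: H_def)
    show ?thesis unfolding T'_def T_def R' e4 e3 e2 e1
      by (simp add: algebra_simps del: power_Suc sum.atMost_Suc)
  qed
  have "(\<Sum>s\<le>N. T' s) = (\<Sum>s\<le>N. T s) + (\<Sum>s\<le>N. H (Suc s) - H s)"
    by (simp add: step sum.distrib[symmetric])
  also have "(\<Sum>s\<le>N. H (Suc s) - H s) = H (Suc N)"
    by (induction N) (simp_all add: H_def)
  finally have "(\<Sum>s\<le>Suc N. T' s) = (\<Sum>s\<le>N. T s) + (H (Suc N) + T' (Suc N))"
    by simp
  \<comment> \<open>The surviving telescoping term and the new summand are the two pentagonal terms
    for \<open>N + 1\<close>.\<close>
  also have "H (Suc N) + T' (Suc N) =
     (-1) ^ Suc N * (q ^ (Suc N * (Suc N - 1) + \<Sum>{..Suc N}) + q ^ (Suc N * Suc N + \<Sum>{..Suc N}))"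
    by (simp add: H_def T'_def R_def distrib_left del: sum.atMost_Suc power_Suc)
  also have "(\<Sum>s\<le>N. T s) = 1 + (\<Sum>j=1..N. (-1) ^ j * (q ^ (j * (j - 1) + \<Sum>{..j}) + q ^ (j * j + \<Sum>{..j})))"
    unfolding T_def R_def by (rule Suc.IH)
  finally show ?case unfolding T'_def by (simp del: sum.atMost_Suc power_Suc)
qed simp

text \<open>In Shanks' sum with \<open>q = X^2\<close>, the summand \<open>s = 0\<close> is the
  product, and for \<open>s > 0\<close> the exponent \<open>s N + s(s+1)/2\<close> is at least
  \<open>N + 1\<close>. The indices \<open>j\<close> and \<open>-j\<close> give the two terms of
  each pair.\<close>

lemma pentagonal_fps_cong:
  "fps_cong (2 * Suc N) (qfact (fps_X\<^sup>2 :: 'a::comm_ring_1 fps) N)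
     (\<Sum>j=-int N..int N. (-1) ^ nat \<bar>j\<bar> * fps_X ^ nat (3 * j\<^sup>2 + j))"
proof -
  define q where "q = (fps_X\<^sup>2 :: 'a fps)"
  define t where "t s = (-1) ^ s * (\<Prod>i\<in>{s..<N}. 1 - q ^ Suc i) * q ^ (s * N + \<Sum>{..s})" for s
  define f where "f j = (-1) ^ nat \<bar>j\<bar> * (fps_X :: 'a fps) ^ nat (3 * j\<^sup>2 + j)" for j :: int
  have tri: "2 * \<Sum>{..j} = j * Suc j" for j :: nat
    by (induction j) auto
  have f_pos: "f (int j) = (-1) ^ j * q ^ (j * j + \<Sum>{..j})" for j :: nat
  proof -
    have "int (2 * (j * j + \<Sum>{..j})) = 3 * (int j)\<^sup>2 + int j"
      unfolding distrib_left tri by (simp add: power2_eq_square algebra_simps)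
    then have "nat (3 * (int j)\<^sup>2 + int j) = 2 * (j * j + \<Sum>{..j})" by (metis nat_int)
    then show ?thesis by (simp only: f_def q_def power_mult[symmetric] abs_of_nat nat_int)
  qed
  have f_neg: "f (- int j) = (-1) ^ j * q ^ (j * (j - 1) + \<Sum>{..j})" for j :: nat
  proof -
    have "int (2 * (j * (j - 1) + \<Sum>{..j})) = 3 * (int j)\<^sup>2 - int j"
      unfolding distrib_left tri by (cases j) (simp_all add: power2_eq_square algebra_simps)
    then have "nat (3 * (- int j)\<^sup>2 + - int j) = 2 * (j * (j - 1) + \<Sum>{..j})"
      by (metis nat_int power2_minus uminus_add_conv_diff add.commute)
    then show ?thesis by (simp only: f_def q_def power_mult[symmetric] abs_minus_cancel abs_of_nat nat_int)
  qed
  have "(\<Sum>j=-int M..int M. f j) = 1 + (\<Sum>j=1..M. f (- int j) + f (int j))" for M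
  proof (induction M)
    case 0
    show ?case by (simp add: f_def)
  next
    case (Suc M)
    have "{- int (Suc M)..int (Suc M)} = insert (- int (Suc M)) (insert (int (Suc M)) {- int M..int M})"
      by auto
    then show ?case by (simp add: Suc.IH algebra_simps)
  qed
  then have rhs: "(\<Sum>j=-int N..int N. f j) = (\<Sum>s\<le>N. t s)"
    unfolding t_def pentagonal_finite f_pos f_neg by (simp add: distrib_left)
  have "fps_cong (2 * Suc N) (\<Sum>s\<in>{1..N}. t s) (\<Sum>s\<in>{1..N}. 0)"
  proof (intro fps_cong_sum)
    fix s assume s: "s \<in> {1..N}"
    then have "Suc N \<le> s * N + \<Sum>{..s}"
      using mult_le_mono1[of 1 s N] tri[of s] by (cases s) auto
    then have "q ^ Suc N dvd q ^ (s * N + \<Sum>{..s})" by (rule le_imp_power_dvd)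
    then have "q ^ Suc N dvd t s" unfolding t_def by (rule dvd_mult)
    then show "fps_cong (2 * Suc N) (t s) 0"
      by (simp only: fps_cong_def q_def power_mult[symmetric] diff_0_right)
  qed
  then have "fps_cong (2 * Suc N) (t 0) (t 0 + (\<Sum>s\<in>{1..N}. t s))"
    by (simp add: fps_cong_iff)
  also have "t 0 = qfact q N" by (simp add: t_def qfact_def lessThan_atLeast0)
  also have "qfact q N + (\<Sum>s\<in>{1..N}. t s) = (\<Sum>s\<le>N. t s)"
    unfolding \<open>t 0 = qfact q N\<close>[symmetric] atMost_atLeast0 by (simp add: sum.atLeast_Suc_atMost)
  finally show ?thesis unfolding rhs[symmetric] f_def q_def .
qed

subsection \<open>Leading terms of the series\<close>

lemma fps_cong_cancel_unit:
  fixes u :: "complex fps"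
  assumes "fps_nth u 0 \<noteq> 0" "fps_cong m (f * u) (g * u)"
  shows "fps_cong m f g"
proof -
  have "fps_cong m (f * u * inverse u) (g * u * inverse u)"
    using assms(2) fps_cong_refl by (rule fps_cong_mult)
  moreover have *: "h * u * inverse u = h" for h
    using inverse_mult_eq_1'[OF assms(1)] by (simp only: mult.assoc mult_1_right)
  ultimately show ?thesis unfolding * by blast
qed

lemma prodinf_nth_0:
  fixes f :: "nat \<Rightarrow> complex fps"
  assumes f: "\<And>i. fps_cong (Suc i) (f i) 1"
  shows "fps_nth (prodinf f) 0 = 1"
  using prodinf_fps_cong[OF f, of 1] f[of 0] by (simp add: fps_cong_iff)

lemma fps_cong_one_minus_power: "i < e \<Longrightarrow> fps_cong (Suc i) (1 - fps_X ^ e) (1 :: complex fps)"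
  by (simp add: fps_cong_iff)

lemma wt_prod: "(\<Prod>i<k. wt fps_X (fps_X ^ b) i) = (fps_X :: 'a::comm_ring_1 fps) ^ (\<Sum>i<k. Suc (b * i))"
  by (simp add: wt_def power_sum power_mult)

text \<open>Common source of both leading-term estimates. The squared product clears the
  denominators and leaves a coefficient of the finite theta product, whose Gaussian binomial is
  close to the inverse of the last infinite product.\<close>

lemma ksubsets_series_cong:
  fixes b d k :: nat
  defines "u \<equiv> wt fps_X (fps_X ^ b) :: nat \<Rightarrow> complex fps"
  defines "G \<equiv> \<lambda>k. \<Sum>i<k. Suc (b * i)"
  assumes bd: "d = 0 \<and> b = 2 \<or> d = 1 \<and> b = 1"
  shows "fps_cong (G (Suc k))
    ((\<Sum>\<^sub>\<infinity>T\<in>ksubsets k. \<Prod>t\<in>T. u (t - 1) / (1 - u (t - 1))\<^sup>2) *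
     (\<Prod>i. 1 - u i)\<^sup>2 * (\<Prod>i. 1 - (fps_X ^ b) ^ Suc i)) (fps_X ^ G k)"
proof -
  define Q where "Q = (fps_X ^ b :: complex fps)"
  define M where "M = G (Suc k)"
  \<comment> \<open>Chosen so that both lower q-factorials, with indices \<open>N + d + k\<close>
    and \<open>N - k = M\<close>, already agree with \<open>P\<close> modulo
    \<open>X^M\<close>.\<close>
  define N where "N = M + k"
  define a where "a t = u (t - 1) / (1 - u (t - 1))\<^sup>2" for t
  define P where "P = (\<Prod>i. 1 - Q ^ Suc i)"
  have u_Q: "u = wt fps_X Q" by (simp add: u_def Q_def)
  have u: "u i = fps_X ^ Suc (b * i)" for i
    by (simp add: u_def wt_def power_mult)
  have b: "b \<ge> 1" using bd by auto
  have ub: "i \<le> b * i" for i using b by simp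
  have unit: "fps_nth ((1 - u i)\<^sup>2) 0 \<noteq> 0" for i
    by (simp add: u power2_eq_square)
  have a_eq: "a (Suc i) * (1 - u i)\<^sup>2 = u i" for i
    using inverse_mult_eq_1[OF unit] by (simp add: a_def fps_divide_unit[OF unit] mult.assoc)
  have a_dvd: "fps_X ^ t dvd a t" if "t > 0" for t
  proof -
    have "t \<le> Suc (b * (t - 1))" using ub[of "t - 1"] that by linarith
    then have "fps_X ^ t dvd u (t - 1)"
      unfolding u by (rule le_imp_power_dvd)
    then show ?thesis unfolding a_def fps_divide_unit[OF unit] by (rule dvd_mult2)
  qed
  have Pconv: "fps_cong (Suc i) (1 - Q ^ Suc i) 1" for i
    unfolding Q_def power_mult[symmetric] using ub[of "Suc i"] by (intro fps_cong_one_minus_power) simp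
  have P0: "fps_nth P 0 \<noteq> 0" unfolding P_def using prodinf_nth_0[OF Pconv] by simp
  have P: "fps_cong M (qfact Q n) P" if "M \<le> n" for n
    unfolding P_def qfact_def using prodinf_fps_cong[OF Pconv, of n] that
    by (blast intro: fps_cong_sym fps_cong_mono)
  have "qbin Q (2 * N + d) (N + d + k) * (qfact Q (N + d + k) * qfact Q (2 * N + d - (N + d + k))) = qfact Q (2 * N + d)"
    by (rule qbin_qfact) (simp add: N_def)
  moreover have "fps_cong M (qbin Q (2 * N + d) (N + d + k) * (qfact Q (N + d + k) * qfact Q (2 * N + d - (N + d + k))))
     (qbin Q (2 * N + d) (N + d + k) * (P * P))"
    by (intro fps_cong_mult P fps_cong_refl) (simp_all add: N_def)
  moreover have "fps_cong M (qfact Q (2 * N + d)) P" by (rule P) (simp add: N_def)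
  \<comment> \<open>All three q-factorials become \<open>P\<close>; one copy cancels.\<close>
  ultimately have "fps_cong M ((qbin Q (2 * N + d) (N + d + k) * P) * P) (1 * P)"
    by (simp add: fps_cong_iff mult_ac)
  then have qbin: "fps_cong M (qbin Q (2 * N + d) (N + d + k) * P) 1"
    by (rule fps_cong_cancel_unit[OF P0])
  \<comment> \<open>The square cancels the denominators at indices in \<open>T\<close> and survives
    at the others; the shift is \<open>t = i + 1\<close>.\<close>
  have fin: "(\<Sum>T | T \<subseteq> {1..N} \<and> card T = k. \<Prod>t\<in>T. a t) * (\<Prod>i<N. 1 - u i)\<^sup>2 =
      (\<Sum>T | T \<subseteq> {..<N} \<and> card T = k. (\<Prod>i\<in>T. u i) * (\<Prod>i\<in>{..<N}-T. (1 - u i)\<^sup>2))"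
  proof -
    have "(\<Sum>T | T \<subseteq> {1..N} \<and> card T = k. \<Prod>t\<in>T. a t) = (\<Sum>T | T \<subseteq> {..<N} \<and> card T = k. \<Prod>i\<in>T. a (Suc i))"
    proof (rule sum.reindex_bij_witness[of _ "(`) Suc" "(`) (\<lambda>t. t - 1)"])
      fix T assume "T \<in> {T. T \<subseteq> {1..N} \<and> card T = k}"
      then have T: "T \<subseteq> {1..N}" "card T = k" by auto
      have inj: "inj_on (\<lambda>t. t - 1) T" using T(1) by (intro inj_on_diff_nat) auto
      show "Suc ` (\<lambda>t. t - 1) ` T = T" using T(1) by (force simp: image_image)
      show "(\<lambda>t. t - 1) ` T \<in> {T. T \<subseteq> {..<N} \<and> card T = k}"
        using subsetD[OF T(1)] T(2) card_image[OF inj] by fastforce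
      show "(\<Prod>i\<in>(\<lambda>t. t - 1) ` T. a (Suc i)) = (\<Prod>t\<in>T. a t)"
        unfolding prod.reindex[OF inj] using T(1) by (intro prod.cong) auto
    next
      fix T assume "T \<in> {T. T \<subseteq> {..<N} \<and> card T = k}"
      then show "(\<lambda>t. t - 1) ` Suc ` T = T" "Suc ` T \<in> {T. T \<subseteq> {1..N} \<and> card T = k}"
        by (auto simp: image_image card_image)
    qed
    moreover have "(\<Prod>i\<in>T. a (Suc i)) * (\<Prod>i<N. 1 - u i)\<^sup>2 = (\<Prod>i\<in>T. u i) * (\<Prod>i\<in>{..<N}-T. (1 - u i)\<^sup>2)"
      if "T \<subseteq> {..<N}" for T
    proof -
      have "(\<Prod>i<N. 1 - u i)\<^sup>2 = (\<Prod>i\<in>{..<N}-T. (1 - u i)\<^sup>2) * (\<Prod>i\<in>T. (1 - u i)\<^sup>2)"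
        unfolding prod_power_distrib by (rule prod.subset_diff[OF that]) simp
      moreover have "(\<Prod>i\<in>T. a (Suc i)) * (\<Prod>i\<in>T. (1 - u i)\<^sup>2) = (\<Prod>i\<in>T. u i)"
        by (simp only: prod.distrib[symmetric] a_eq)
      ultimately show ?thesis by (simp add: mult_ac)
    qed
    ultimately show ?thesis by (simp add: sum_distrib_right)
  qed
  have G: "(\<Prod>i<j. u i) = fps_X ^ G j" for j
    unfolding u_def wt_prod G_def ..
  have "fps_cong M ((\<Sum>\<^sub>\<infinity>T\<in>ksubsets k. \<Prod>t\<in>T. a t) * (\<Prod>i. 1 - u i)\<^sup>2 * P)
     ((\<Sum>T | T \<subseteq> {1..N} \<and> card T = k. \<Prod>t\<in>T. a t) * (\<Prod>i<N. 1 - u i)\<^sup>2 * P)"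
  proof (intro fps_cong_mult fps_cong_power fps_cong_refl)
    show "fps_cong M (\<Sum>\<^sub>\<infinity>T\<in>ksubsets k. \<Prod>t\<in>T. a t) (\<Sum>T | T \<subseteq> {1..N} \<and> card T = k. \<Prod>t\<in>T. a t)"
      by (rule fps_cong_mono[OF infsum_ksubsets_fps_cong[OF a_dvd]]) (simp_all add: N_def)
    have "fps_cong (Suc i) (1 - u i) 1" for i
      unfolding u by (intro fps_cong_one_minus_power le_imp_less_Suc ub)
    then show "fps_cong M (\<Prod>i. 1 - u i) (\<Prod>i<N. 1 - u i)"
      by (rule fps_cong_mono[OF prodinf_fps_cong]) (simp add: N_def)
  qed
  also have "fps_cong M \<dots> (fps_X ^ G k * qbin Q (2 * N + d) (N + d + k) * P)"
  proof (rule fps_cong_mult[OF _ fps_cong_refl])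
    have "(\<Prod>i<Suc k. wt fps_X Q i) dvd
      (\<Sum>T | T \<subseteq> {..<N} \<and> card T = k. (\<Prod>i\<in>T. wt fps_X Q i) * (\<Prod>i\<in>{..<N}-T. (1 - wt fps_X Q i)\<^sup>2)) -
      (\<Prod>i<k. wt fps_X Q i) * qbin Q (2 * N + d) (N + d + k)"
    proof (rule finite_theta_coeff)
      show "d = 0 \<and> fps_X\<^sup>2 = Q \<or> d = 1 \<and> fps_X = Q"
        unfolding Q_def using bd by (metis power_one_right)
    qed (simp add: N_def)
    then show "fps_cong M ((\<Sum>T | T \<subseteq> {1..N} \<and> card T = k. \<Prod>t\<in>T. a t) * (\<Prod>i<N. 1 - u i)\<^sup>2)
        (fps_X ^ G k * qbin Q (2 * N + d) (N + d + k))"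
      unfolding G u_Q[symmetric] fin[symmetric] fps_cong_def M_def .
  qed
  also have "fps_cong M \<dots> (fps_X ^ G k * 1)"
    unfolding mult.assoc by (intro fps_cong_mult fps_cong_refl qbin)
  finally show ?thesis by (simp add: M_def a_def P_def Q_def)
qed

text \<open>Positive exponents give every denominator constant term 1, so division is multiplication
  by an inverse and can be carried out factor by factor.\<close>

lemma fps_X_power_sum_divide_prod:
  fixes e :: "nat \<Rightarrow> nat"
  assumes "finite T" "\<And>t. t \<in> T \<Longrightarrow> 0 < e t"
  shows "fps_X ^ (\<Sum>t\<in>T. e t) / (\<Prod>t\<in>T. (1 - fps_X ^ e t)\<^sup>2) =
    (\<Prod>t\<in>T. fps_X ^ e t / (1 - fps_X ^ e t)\<^sup>2 :: complex fps)"
proof -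
  have unit: "fps_nth ((1 - fps_X ^ e t)\<^sup>2 :: complex fps) 0 \<noteq> 0" if "t \<in> T" for t
    using assms(2)[OF that] by (simp add: power2_eq_square)
  have "fps_nth (\<Prod>t\<in>S. (1 - fps_X ^ e t)\<^sup>2 :: complex fps) 0 \<noteq> 0 \<and>
    inverse (\<Prod>t\<in>S. (1 - fps_X ^ e t)\<^sup>2) = (\<Prod>t\<in>S. inverse ((1 - fps_X ^ e t)\<^sup>2) :: complex fps)"
    if "S \<subseteq> T" for S
    using finite_subset[OF that assms(1)] that
    by (induction S) (use unit in \<open>auto simp: fps_inverse_mult\<close>)
  from this[of T] have "fps_X ^ (\<Sum>t\<in>T. e t) / (\<Prod>t\<in>T. (1 - fps_X ^ e t)\<^sup>2) =
      (\<Prod>t\<in>T. fps_X ^ e t * inverse ((1 - fps_X ^ e t)\<^sup>2) :: complex fps)"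
    by (simp add: fps_divide_unit power_sum prod.distrib)
  also have "\<dots> = (\<Prod>t\<in>T. fps_X ^ e t / (1 - fps_X ^ e t)\<^sup>2)"
    by (intro prod.cong refl fps_divide_unit[symmetric] unit)
  finally show ?thesis .
qed

text \<open>For \<open>b = d = 1\<close> the squared product and the last product involve the same
  q-Pochhammer symbol, hence the cube.\<close>

lemma A_series_cong:
  "fps_cong (\<Sum>i<Suc k. Suc i) (A_series k * qpoch fps_X fps_X ^ 3) (fps_X ^ (\<Sum>i<k. Suc i))"
proof -
  have "A_series k = (\<Sum>\<^sub>\<infinity>T\<in>ksubsets k. \<Prod>t\<in>T. wt fps_X (fps_X ^ 1) (t - 1) / (1 - wt fps_X (fps_X ^ 1) (t - 1))\<^sup>2)"
    unfolding A_series_def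
  proof (intro infsum_cong)
    fix T assume "T \<in> ksubsets k"
    then have T: "finite T" "\<And>t. t \<in> T \<Longrightarrow> 0 < t" by (auto simp: ksubsets_def)
    have "wt fps_X (fps_X ^ 1) (t - 1) = (fps_X ^ t :: complex fps)" if "t \<in> T" for t
      using T(2)[OF that] by (cases t) (simp_all add: wt_def)
    then show "fps_X ^ (\<Sum>t\<in>T. t) / (\<Prod>t\<in>T. (1 - fps_X ^ t)\<^sup>2) =
        (\<Prod>t\<in>T. wt fps_X (fps_X ^ 1) (t - 1) / (1 - wt fps_X (fps_X ^ 1) (t - 1))\<^sup>2 :: complex fps)"
      using fps_X_power_sum_divide_prod[OF T] by simp
  qed
  moreover have "(\<Prod>i. 1 - wt fps_X (fps_X ^ 1) i) = qpoch fps_X fps_X"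
    "(\<Prod>i. 1 - (fps_X ^ 1) ^ Suc i) = qpoch fps_X fps_X"
    by (simp_all add: qpoch_def wt_def)
  ultimately show ?thesis
    using ksubsets_series_cong[of 1 1 k]
    by (simp add: power2_eq_square power3_eq_cube mult.assoc)
qed

lemma C_series_cong:
  "fps_cong ((Suc k)\<^sup>2) (C_series k * qpoch fps_X (fps_X\<^sup>2) ^ 2 * qpoch (fps_X\<^sup>2) (fps_X\<^sup>2)) (fps_X ^ k\<^sup>2)"
proof -
  have "C_series k = (\<Sum>\<^sub>\<infinity>T\<in>ksubsets k. \<Prod>t\<in>T. wt fps_X (fps_X\<^sup>2) (t - 1) / (1 - wt fps_X (fps_X\<^sup>2) (t - 1))\<^sup>2)"
    unfolding C_series_def
  proof (intro infsum_cong)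
    fix T assume "T \<in> ksubsets k"
    then have T: "finite T" "\<And>t. t \<in> T \<Longrightarrow> 0 < t" and k: "k = (\<Sum>t\<in>T. 1)"
      by (auto simp: ksubsets_def)
    have "wt fps_X (fps_X\<^sup>2) (t - 1) = (fps_X ^ (2 * t - 1) :: complex fps)" if "t \<in> T" for t
      using T(2)[OF that] by (cases t) (simp_all add: wt_def flip: power_mult)
    \<comment> \<open>Writing \<open>k\<close> as a sum of ones lets the natural subtraction be done
      termwise, as \<open>2 * t\<close> is at least 1.\<close>
    moreover have "(\<Sum>t\<in>T. 2 * t) - k = (\<Sum>t\<in>T. 2 * t - 1)"
      unfolding k using T(2) by (intro sum_subtractf_nat[symmetric]) force
    moreover have "0 < 2 * t - 1" if "t \<in> T" for t using T(2)[OF that] by simp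
    ultimately show "fps_X ^ ((\<Sum>t\<in>T. 2 * t) - k) / (\<Prod>t\<in>T. (1 - fps_X ^ (2 * t - 1))\<^sup>2) =
        (\<Prod>t\<in>T. wt fps_X (fps_X\<^sup>2) (t - 1) / (1 - wt fps_X (fps_X\<^sup>2) (t - 1))\<^sup>2 :: complex fps)"
      using fps_X_power_sum_divide_prod[OF T(1), of "\<lambda>t. 2 * t - 1"] by simp
  qed
  moreover have "(\<Prod>i. 1 - wt fps_X (fps_X\<^sup>2) i) = qpoch fps_X (fps_X\<^sup>2)"
    "(\<Prod>i. 1 - (fps_X\<^sup>2) ^ Suc i) = qpoch (fps_X\<^sup>2) (fps_X\<^sup>2)"
    by (simp_all add: qpoch_def wt_def)
  moreover have "(\<Sum>i<m. Suc (2 * i)) = m\<^sup>2" for m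
    by (induction m) (auto simp: power2_eq_square)
  ultimately show ?thesis
    using ksubsets_series_cong[of 0 2 k] by simp
qed

text \<open>The error is \<open>(f - X^a) g + X^a (g - X^b)\<close>, and \<open>b <= b'\<close>
  makes \<open>g\<close> divisible by \<open>X^b\<close>. So each error gains the order of the other
  factor.\<close>

lemma fps_cong_mult_X_power:
  fixes f g :: "'a::comm_ring_1 fps"
  assumes f: "fps_cong a' f (fps_X ^ a)" and g: "fps_cong b' g (fps_X ^ b)"
    and "m \<le> a' + b" "m \<le> a + b'" "b \<le> b'"
  shows "fps_cong m (f * g) (fps_X ^ (a + b))"
proof -
  have "fps_X ^ b dvd (g - fps_X ^ b) + fps_X ^ b"
    using g le_imp_power_dvd[OF \<open>b \<le> b'\<close>, of "fps_X :: 'a fps"] unfolding fps_cong_def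
    by (intro dvd_add) (auto intro: dvd_trans)
  then have "fps_X ^ (a' + b) dvd (f - fps_X ^ a) * g"
    using f unfolding power_add fps_cong_def by (intro mult_dvd_mono) simp_all
  moreover have "fps_X ^ (a + b') dvd fps_X ^ a * (g - fps_X ^ b)"
    using g unfolding power_add fps_cong_def by (intro mult_dvd_mono) simp_all
  ultimately have "fps_X ^ m dvd (f - fps_X ^ a) * g + fps_X ^ a * (g - fps_X ^ b)"
    using assms(3,4) by (intro dvd_add) (meson dvd_trans le_imp_power_dvd)+
  then show ?thesis by (simp add: fps_cong_def power_add algebra_simps)
qed

subsection \<open>Summation over the index range\<close>

text \<open>Floor plus 1 and ceiling minus 1 encode strict bounds. For \<open>k = n + 2j\<close>
  they read \<open>|6j + 1| < sqrt (12n + 13)\<close>; squaring gives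
  \<open>3j^2 + j < n + 1\<close>.\<close>

lemma summation_range_eq:
  fixes n :: nat
  shows "{k. k \<in> {\<lfloor>(3 * real n - 1 - sqrt (12 * real n + 13)) / 3\<rfloor> + 1..
                  \<lceil>(3 * real n - 1 + sqrt (12 * real n + 13)) / 3\<rceil> - 1} \<and> [k = int n] (mod 2)} =
         (\<lambda>j. int n + 2 * j) ` {j. 3 * j\<^sup>2 + j \<le> int n}"
proof -
  have range: "int n + 2 * j \<in> {\<lfloor>(3 * real n - 1 - sqrt (12 * real n + 13)) / 3\<rfloor> + 1..
                  \<lceil>(3 * real n - 1 + sqrt (12 * real n + 13)) / 3\<rceil> - 1} \<longleftrightarrow> 3 * j\<^sup>2 + j \<le> int n" for j
  proof -
    define s where "s = sqrt (12 * real n + 13)"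
    have "int n + 2 * j \<in> {\<lfloor>(3 * real n - 1 - s) / 3\<rfloor> + 1..\<lceil>(3 * real n - 1 + s) / 3\<rceil> - 1} \<longleftrightarrow>
        \<lfloor>(3 * real n - 1 - s) / 3\<rfloor> < int n + 2 * j \<and> int n + 2 * j < \<lceil>(3 * real n - 1 + s) / 3\<rceil>"
      by auto
    also have "\<dots> \<longleftrightarrow> \<bar>real_of_int (6 * j + 1)\<bar> < s"
      unfolding floor_less_iff less_ceiling_iff by (auto simp: field_simps abs_less_iff)
    also have "\<dots> \<longleftrightarrow> (real_of_int (6 * j + 1))\<^sup>2 < 12 * real n + 13"
      unfolding s_def real_sqrt_abs[symmetric] by (rule real_sqrt_less_iff)
    also have "\<dots> \<longleftrightarrow> real_of_int ((6 * j + 1)\<^sup>2) < real_of_int (12 * int n + 13)"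
      by simp
    also have "\<dots> \<longleftrightarrow> 3 * j\<^sup>2 + j \<le> int n"
      unfolding of_int_less_iff by (auto simp: power2_eq_square algebra_simps)
    finally show ?thesis unfolding s_def .
  qed
  show ?thesis
  proof (intro equalityI subsetI)
    fix k assume k: "k \<in> {k. k \<in> {\<lfloor>(3 * real n - 1 - sqrt (12 * real n + 13)) / 3\<rfloor> + 1..
                  \<lceil>(3 * real n - 1 + sqrt (12 * real n + 13)) / 3\<rceil> - 1} \<and> [k = int n] (mod 2)}"
    then have "[int n = k] (mod 2)" by (auto simp: cong_sym)
    then obtain j where "k = int n + 2 * j" by (auto simp: cong_iff_lin)
    then show "k \<in> (\<lambda>j. int n + 2 * j) ` {j. 3 * j\<^sup>2 + j \<le> int n}"
      using k range[of j] by blast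
  next
    fix k assume "k \<in> (\<lambda>j. int n + 2 * j) ` {j. 3 * j\<^sup>2 + j \<le> int n}"
    then obtain j where "k = int n + 2 * j" "3 * j\<^sup>2 + j \<le> int n" by blast
    then show "k \<in> {k. k \<in> {\<lfloor>(3 * real n - 1 - sqrt (12 * real n + 13)) / 3\<rfloor> + 1..
                  \<lceil>(3 * real n - 1 + sqrt (12 * real n + 13)) / 3\<rceil> - 1} \<and> [k = int n] (mod 2)}"
      using range[of j] by (auto simp: cong_def)
  qed
qed

lemma A_series_times_C_series_cong:
  fixes j :: int and n :: nat
  assumes j: "3 * j\<^sup>2 + j \<le> int n"
  shows "fps_cong ((3 * n\<^sup>2 + n) div 2 + (n + 1))
    (A_series (nat (int n + 2 * j)) * C_series (nat (int n - j)) *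
      (Theta6 * qpoch (fps_X\<^sup>2) (fps_X\<^sup>2)))
    (fps_X ^ ((3 * n\<^sup>2 + n) div 2 + nat (3 * j\<^sup>2 + j)))"
proof -
  have jle: "j \<le> j\<^sup>2" "- j \<le> j\<^sup>2"
  proof -
    have "\<bar>j\<bar> \<le> j\<^sup>2" using self_le_power[of "\<bar>j\<bar>" 2] by (cases "j = 0") simp_all
    then show "j \<le> j\<^sup>2" "- j \<le> j\<^sup>2" by linarith+
  qed
  define k m where "k = nat (int n + 2 * j)" and "m = nat (int n - j)"
  \<comment> \<open>The hypothesis gives \<open>n + 2j >= 3j^2 + 3j >= 0\<close> and
    \<open>n - j >= 3j^2 >= 0\<close>, so \<open>nat\<close> truncates nothing.\<close>
  have k: "int k = int n + 2 * j" and m: "int m = int n - j"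
    using j jle by (simp_all add: k_def m_def)
  define h where "h = (3 * n\<^sup>2 + n) div 2"
  define g where "g = (\<Sum>i<k. Suc i)"
  have "2 * (\<Sum>i<k. Suc i) = k * Suc k" for k by (induction k) auto
  then have "2 * g = k * Suc k" by (simp only: g_def)
  then have "int (2 * g) = int (k * Suc k)" by (simp only:)
  then have g: "2 * int g = int k * (int k + 1)" by (simp add: algebra_simps)
  have "2 * h = 3 * n\<^sup>2 + n" unfolding h_def by simp
  then have "int (2 * h) = int (3 * n\<^sup>2 + n)" by (simp only:)
  then have h: "2 * int h = 3 * (int n)\<^sup>2 + int n" by simp
  have exponent: "int g + (int m)\<^sup>2 = int h + (3 * j\<^sup>2 + j)"
    using g h unfolding k m by (simp add: power2_eq_square algebra_simps)
  have "0 \<le> 3 * j\<^sup>2 + j" using jle by linarith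
  then have exponent': "g + m\<^sup>2 = h + nat (3 * j\<^sup>2 + j)"
    using exponent by (simp add: nat_eq_iff2 flip: of_nat_power of_nat_add of_nat_eq_iff[where 'a = int])
  have "fps_cong (h + (n + 1)) ((A_series k * qpoch fps_X fps_X ^ 3) *
      (C_series m * qpoch fps_X (fps_X\<^sup>2) ^ 2 * qpoch (fps_X\<^sup>2) (fps_X\<^sup>2))) (fps_X ^ (g + m\<^sup>2))"
  proof (rule fps_cong_mult_X_power[OF _ C_series_cong])
    show "fps_cong (g + Suc k) (A_series k * qpoch fps_X fps_X ^ 3) (fps_X ^ g)"
      using A_series_cong[of k] by (simp add: g_def)
    \<comment> \<open>The error from the A-factor has surplus order
      \<open>3j^2 + 3j\<close>.\<close>
    have "int (h + (n + 1)) \<le> int (g + Suc k + m\<^sup>2)"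
      using exponent k jle by simp
    then show "h + (n + 1) \<le> g + Suc k + m\<^sup>2" by (simp only: of_nat_le_iff)
    \<comment> \<open>The error from the C-factor has surplus order \<open>3j^2 + m\<close>.\<close>
    have "int (h + (n + 1)) \<le> int (g + (Suc m)\<^sup>2)"
    proof -
      have "int (g + (Suc m)\<^sup>2) = (int g + (int m)\<^sup>2) + 2 * int m + 1"
        by (simp add: power2_eq_square algebra_simps)
      moreover have "int (h + (n + 1)) = int h + int n + 1" by simp
      ultimately show ?thesis using jle exponent m by linarith
    qed
    then show "h + (n + 1) \<le> g + (Suc m)\<^sup>2" by (simp only: of_nat_le_iff)
  qed (simp add: power2_eq_square)
  then show ?thesis unfolding exponent' unfolding Theta6_def h_def k_def m_def
    by (simp add: mult_ac)
qed

text \<open>For \<open>k = n + 2j\<close> the exponent \<open>(n - k)/2 = -j\<close> may be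
  negative; only its parity matters.\<close>

lemma minus_one_powi: "(-1 :: 'a::field) powi i = (-1) ^ nat \<bar>i\<bar>"
  by (cases "0 \<le> i") (simp_all add: power_int_def minus_one_power_iff even_nat_iff)

theorem lemma2p1:
  fixes n :: nat and r1 r2 :: int
  assumes "n > 0"
    and "r1 = \<lfloor>(3 * real n - 1 - sqrt (12 * real n + 13)) / 3\<rfloor> + 1"
    and "r2 = \<lceil>(3 * real n - 1 + sqrt (12 * real n + 13)) / 3\<rceil> - 1"
  shows "\<exists>R \<in> big_O_q (n + 1).
    1 / fps_to_fls Theta6 =
      fls_X_intpow (- int ((3 * n ^ 2 + n) div 2)) *
        (\<Sum>k | k \<in> {r1..r2} \<and> [k = int n] (mod 2).
          (- 1) powi ((int n - k) div 2) *
          fps_to_fls (A_series (nat k) * C_series (nat ((3 * int n - k) div 2))))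
      + fps_to_fls R"
proof -
  define h where "h = (3 * n\<^sup>2 + n) div 2"
  define J where "J = {j :: int. 3 * j\<^sup>2 + j \<le> int n}"
  define E where "E = qpoch (fps_X\<^sup>2) (fps_X\<^sup>2)"
  define F where "F j = (-1) ^ nat \<bar>j\<bar> * (A_series (nat (int n + 2 * j)) * C_series (nat (int n - j)))" for j :: int
  define t where "t j = (-1) ^ nat \<bar>j\<bar> * (fps_X :: complex fps) ^ nat (3 * j\<^sup>2 + j)" for j :: int
  define S where "S = (\<Sum>j\<in>J. F j)"
  \<comment> \<open>From \<open>3j^2 + j >= 2|j|\<close>. This makes \<open>J\<close> finite and
    puts it inside the range of the pentagonal sum.\<close>
  have J_sub: "J \<subseteq> {-int n..int n}"
  proof
    fix j assume j: "j \<in> J"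
    have "\<bar>j\<bar> \<le> j\<^sup>2" using self_le_power[of "\<bar>j\<bar>" 2] by (cases "j = 0") simp_all
    then show "j \<in> {-int n..int n}" using j unfolding J_def by auto
  qed
  have Xconv: "fps_cong (Suc i) (1 - (fps_X ^ b) ^ i * fps_X ^ c) (1 :: complex fps)" if "b \<ge> 1" "c \<ge> 1" for i b c
  proof -
    have "i \<le> b * i" using that(1) by simp
    then have "i < b * i + c" using that(2) by linarith
    from fps_cong_one_minus_power[OF this] show ?thesis
      by (simp add: power_add power_mult)
  qed
  \<comment> \<open>Indices outside \<open>J\<close> have exponent at least \<open>n + 1\<close>, so
    \<open>J\<close> is the pentagonal series cut off at the required order.\<close>
  have E: "fps_cong (Suc n) E (\<Sum>j\<in>J. t j)"
  proof -
    have "fps_cong (Suc n) E (qfact (fps_X\<^sup>2) (Suc n))"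
      unfolding E_def qpoch_def qfact_def power_Suc
      by (rule prodinf_fps_cong) (use Xconv[of 2 2] in \<open>simp add: mult.commute\<close>)
    also have "fps_cong (Suc n) \<dots> (\<Sum>j=-int (Suc n)..int (Suc n). t j)"
      unfolding t_def by (rule fps_cong_mono[OF pentagonal_fps_cong]) simp
    also have "fps_cong (Suc n) \<dots> (\<Sum>j\<in>{-int (Suc n)..int (Suc n)}. if j \<in> J then t j else 0)"
    proof (rule fps_cong_sum)
      fix j :: int
      show "fps_cong (Suc n) (t j) (if j \<in> J then t j else 0)"
      proof (cases "j \<in> J")
        case False
        then have "Suc n \<le> nat (3 * j\<^sup>2 + j)" by (simp add: J_def)
        then have "fps_X ^ Suc n dvd (fps_X :: complex fps) ^ nat (3 * j\<^sup>2 + j)"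
          by (rule le_imp_power_dvd)
        then have "fps_X ^ Suc n dvd t j" unfolding t_def by (rule dvd_mult)
        then show ?thesis using False by (simp only: fps_cong_def if_False diff_0_right)
      qed simp
    qed
    also have "(\<Sum>j\<in>{-int (Suc n)..int (Suc n)}. if j \<in> J then t j else 0) = (\<Sum>j\<in>J. t j)"
      using J_sub by (intro sum.mono_neutral_cong_right) auto
    finally show ?thesis .
  qed
  have unit: "fps_nth (qpoch (fps_X ^ c) (fps_X ^ b)) 0 = 1" if "b \<ge> 1" "c \<ge> 1" for b c
    unfolding qpoch_def by (rule prodinf_nth_0) (use Xconv[OF that] in \<open>simp add: mult.commute\<close>)
  have Theta0: "fps_nth Theta6 0 = 1" and E0: "fps_nth E 0 = 1"
    using unit[of 1 1] unit[of 2 1] unit[of 2 2]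
    by (simp_all add: Theta6_def E_def power2_eq_square power3_eq_cube)
  have "fps_cong (h + (n + 1)) (S * Theta6 * E) (\<Sum>j\<in>J. (-1) ^ nat \<bar>j\<bar> * fps_X ^ (h + nat (3 * j\<^sup>2 + j)))"
    unfolding S_def sum_distrib_right
  proof (rule fps_cong_sum)
    fix j assume "j \<in> J"
    then have "fps_cong (h + (n + 1)) ((-1) ^ nat \<bar>j\<bar> *
        (A_series (nat (int n + 2 * j)) * C_series (nat (int n - j)) * (Theta6 * E)))
        ((-1) ^ nat \<bar>j\<bar> * fps_X ^ (h + nat (3 * j\<^sup>2 + j)))"
      unfolding h_def E_def J_def by (intro fps_cong_mult fps_cong_refl A_series_times_C_series_cong) simp
    then show "fps_cong (h + (n + 1)) (F j * Theta6 * E) ((-1) ^ nat \<bar>j\<bar> * fps_X ^ (h + nat (3 * j\<^sup>2 + j)))"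
      by (simp only: F_def mult.assoc)
  qed
  also have "(\<Sum>j\<in>J. (-1) ^ nat \<bar>j\<bar> * fps_X ^ (h + nat (3 * j\<^sup>2 + j))) = fps_X ^ h * (\<Sum>j\<in>J. t j)"
    by (simp add: t_def sum_distrib_left power_add mult_ac)
  also have "fps_cong (h + (n + 1)) \<dots> (fps_X ^ h * E)"
    using fps_cong_sym[OF E] unfolding fps_cong_def power_add right_diff_distrib[symmetric]
    by (intro mult_dvd_mono) (simp_all add: mult.commute)
  finally have "fps_cong (h + (n + 1)) (S * Theta6) (fps_X ^ h)"
    by (rule fps_cong_cancel_unit[rotated]) (simp add: E0)
  moreover have "inverse Theta6 * Theta6 = 1" using Theta0 by (intro inverse_mult_eq_1) simp
  ultimately have "fps_cong (h + (n + 1)) (S * Theta6) ((fps_X ^ h * inverse Theta6) * Theta6)"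
    by (simp add: mult.assoc)
  then have "fps_cong (h + (n + 1)) (fps_X ^ h * inverse Theta6) S"
    by (rule fps_cong_sym[OF fps_cong_cancel_unit, rotated]) (simp add: Theta0)
  then obtain R where R: "fps_X ^ h * inverse Theta6 - S = fps_X ^ (h + (n + 1)) * R"
    unfolding fps_cong_def by (elim dvdE)
  define shift where "shift i = (fls_X_intpow i :: complex fls)" for i
  have shift: "shift (- int h) * fps_to_fls (fps_X ^ h * f) = fps_to_fls f" for f
  proof -
    have "fps_to_fls (fps_X ^ h) = shift (int h)"
      unfolding shift_def by (simp add: fps_to_fls_power fls_X_power_conv_shift_1)
    moreover have "shift (- int h) * shift (int h) = 1"
      unfolding shift_def fls_X_intpow_times_fls_X_intpow by simp
    ultimately show ?thesis
      by (simp only: fls_times_fps_to_fls mult.assoc[symmetric] mult_1_left)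
  qed
  define G where "G k = (- 1) powi ((int n - k) div 2) *
      fps_to_fls (A_series (nat k) * C_series (nat ((3 * int n - k) div 2)))" for k
  have G: "G (int n + 2 * j) = fps_to_fls (F j)" for j
  proof -
    have "(int n - (int n + 2 * j)) div 2 = - j" "(3 * int n - (int n + 2 * j)) div 2 = int n - j"
      by simp_all
    then show ?thesis
      by (simp add: G_def F_def fls_times_fps_to_fls fps_to_fls_power minus_one_powi)
  qed
  have "(\<Sum>k | k \<in> {r1..r2} \<and> [k = int n] (mod 2). G k) = (\<Sum>k\<in>(\<lambda>j. int n + 2 * j) ` J. G k)"
    unfolding assms(2,3) summation_range_eq J_def ..
  also have "\<dots> = (\<Sum>j\<in>J. fps_to_fls (F j))"
    by (subst sum.reindex) (simp_all add: inj_on_def G)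
  also have "\<dots> = fps_to_fls S"
    unfolding S_def by (induction J rule: infinite_finite_induct) simp_all
  finally have sum: "(\<Sum>k | k \<in> {r1..r2} \<and> [k = int n] (mod 2). G k) = fps_to_fls S" .
  \<comment> \<open>Factoring out \<open>X^h\<close> shows the witness for the error term:
    \<open>X^(n+1) * R\<close>.\<close>
  have "S = fps_X ^ h * (inverse Theta6 - fps_X ^ (n + 1) * R)"
    using R by (simp add: algebra_simps power_add)
  then have "shift (- int h) * fps_to_fls S = fps_to_fls (inverse Theta6 - fps_X ^ (n + 1) * R)"
    by (simp only: shift)
  moreover have "fps_to_fls (inverse Theta6) = 1 / fps_to_fls Theta6"
    using Theta0 by (simp add: fls_inverse_fps_to_fls divide_inverse subdegree_eq_0_iff)
  ultimately have "1 / fps_to_fls Theta6 = shift (- int h) * fps_to_fls S + fps_to_fls (fps_X ^ (n + 1) * R)"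
    by simp
  moreover have "fps_X ^ (n + 1) * R \<in> big_O_q (n + 1)"
    unfolding big_O_q_def using fps_X_power_dvd_iff[of "n + 1" "fps_X ^ (n + 1) * R"] by simp
  ultimately show ?thesis unfolding G_def[symmetric] sum shift_def h_def by blast
qed

end
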